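(* Let $w\in\mathbb{C}$ with $\operatorname{Re}(w)>-1$. Then the function of the complex variable $z$ $$\frac{1}{\pi}\sum_{k=0}^{\infty}\binom{w}{k}\,\mathrm{Si}(\pi z-\pi k)$$ is an antiderivative of the function $z\mapsto\binom{w}{z}$.
   Context: For $w\in\mathbb{C}$ not a negative integer and $z\in\mathbb{C}$, the generalized binomial coefficient is $\binom{w}{z}=\frac{\Gamma(w+1)}{\Gamma(z+1)\Gamma(w-z+1)}$, where the reciprocal gamma function $1/\Gamma$ is understood as an entire function (equal to $0$ at the nonpositive integers). For an integer $k\ge 1$ one has $\binom{w}{k}=\frac{w(w-1)\cdots(w-k+1)}{k!}$, and $\binom{w}{0}=1$. The sine integral is $\mathrm{Si}(z)=\int_0^z\frac{\sin t}{t}\,dt$ (the integrand being extended by $1$ at $t=0$). *)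

theory Defs
  imports "HOL-Complex_Analysis.Complex_Analysis"
begin

(* rGamma is the entire reciprocal Gamma function. The intended domain of w excludes the
   negative integers, where the library's Gamma (w + 1) takes the dummy value 0. *)
definition gen_binomial :: "complex \<Rightarrow> complex \<Rightarrow> complex" where
  "gen_binomial w z = Gamma (w + 1) * rGamma (z + 1) * rGamma (w - z + 1)"

lemma gen_binomial_of_nat:
  assumes "w + 1 \<notin> \<int>\<^sub>\<le>\<^sub>0"
  shows "gen_binomial w (of_nat k) = w gchoose k"
  using gbinomial_Gamma[OF assms, of k]
  by (simp add: gen_binomial_def rGamma_inverse_Gamma Gamma_fact add.commute[of _ 1]
      divide_inverse mult.assoc)

definition complex_sinc :: "complex \<Rightarrow> complex" where
  "complex_sinc t = (if t = 0 then 1 else sin t / t)"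

(* The integrand is entire, so integrating along the straight segment is no restriction. *)
definition sin_integral :: "complex \<Rightarrow> complex" where
  "sin_integral z = contour_integral (linepath 0 z) complex_sinc"

end

(*
  By Euler's Beta integral, expanding (1 - t)^w and integrating termwise gives
    B(x, w + 1) = sum_k (-1)^k binom(w, k) / (x + k)    for real w > 0 and x > 1.
  Multiplying by sin(pi x) / pi and using the reflection formula turns this into
    binom(w, z) = sum_k binom(w, k) sin(pi (z - k)) / (pi (z - k))    for z = -x.
  Since |binom(w, k)| = O(k^(-Re w - 1)) locally uniformly in w, the right-hand side is holomorphic
  in w on Re w > -1 and entire in z, so the identity theorem, first in w and then in z, extends the
  formula to all the required w and z. Its antiderivative is found termwise; this needs the
  convergence of the series of sine integrals at one point, for which z = 0 is convenient.
*)
theory Submission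
  imports Defs
begin

section \<open>The size of the coefficients\<close>

text \<open>Up to sign, the coefficient is the product of 1 - (w + 1)/m over m = 1, ..., k. With a =
  Re (w + 1) and B = |w + 1|^2, each factor has squared modulus 1 - 2a/m + B/m^2 <= exp (B/m^2 -
  2a/m), so the product is governed by the harmonic numbers and the partial sums of zeta(2). The
  constant depends on w only through |w + 1|, hence is locally uniform.\<close>

lemma norm_gbinomial_le:
  fixes w :: complex
  assumes "Re w \<ge> -1"
  shows "norm (w gchoose k) \<le> exp (pi\<^sup>2 / 12 * (norm (w + 1))\<^sup>2) * real (Suc k) powr (- Re (w + 1))"
proof -
  define a B where "a = Re (w + 1)" and "B = (norm (w + 1))\<^sup>2"
  define q where "q = (\<lambda>k. \<Sum>j<k. 1 / (real j + 1)\<^sup>2)"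
  have sq: "(norm (w gchoose k))\<^sup>2 \<le> exp (B * q k - 2 * a * harm k)" for k
  proof (induction k)
    case 0
    show ?case by (simp add: q_def harm_def)
  next
    case (Suc k)
    define m where "m = real (Suc k)"
    have m: "m > 0" by (simp add: m_def)
    have "w gchoose Suc k = (w gchoose k) * ((w - of_nat k) / of_nat (Suc k))"
      using gbinomial_mult_1[of w k] by (simp add: field_simps del: of_nat_Suc)
    also have "(w - of_nat k) / of_nat (Suc k) = - (1 - (w + 1) / of_real m)"
      by (simp add: m_def divide_simps del: of_nat_Suc) simp
    finally have "(norm (w gchoose Suc k))\<^sup>2
        = (norm (w gchoose k))\<^sup>2 * (norm (1 - (w + 1) / of_real m))\<^sup>2"
      by (simp only: norm_mult norm_minus_cancel power_mult_distrib)
    also have "\<dots> \<le> exp (B * q k - 2 * a * harm k) * exp (B / m\<^sup>2 - 2 * a / m)"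
    proof (rule mult_mono'[OF Suc.IH])
      have "(norm (1 - (w + 1) / of_real m))\<^sup>2 = 1 + (B / m\<^sup>2 - 2 * a / m)"
        using m unfolding cmod_power2 B_def a_def
        by (simp add: Re_divide_of_real Im_divide_of_real power2_eq_square field_simps)
      then show "(norm (1 - (w + 1) / of_real m))\<^sup>2 \<le> exp (B / m\<^sup>2 - 2 * a / m)"
        by (simp only: exp_ge_add_one_self)
    qed auto
    also have "\<dots> = exp (B * q (Suc k) - 2 * a * harm (Suc k))"
    proof -
      have "q (Suc k) = q k + 1 / m\<^sup>2" by (simp add: q_def m_def add.commute)
      moreover have "harm (Suc k) = harm k + 1 / m" by (simp add: harm_Suc m_def inverse_eq_divide)
      ultimately show ?thesis by (simp add: algebra_simps flip: exp_add)
    qed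
    finally show ?case .
  qed
  have a: "a \<ge> 0" using assms by (simp add: a_def)
  have q: "q k \<le> pi\<^sup>2 / 6"
    unfolding q_def using inverse_squares_sums
    by (intro sum_le_suminf[THEN order_trans]) (auto simp: sums_iff add_ac)
  have "(norm (w gchoose k))\<^sup>2 \<le> exp (B * q k - 2 * a * harm k)" by (rule sq)
  \<comment> \<open>Here a >= 0 is essential: it lets \<open>harm k\<close> be replaced by the
    smaller ln (k + 1).\<close>
  also have "\<dots> \<le> exp (B * (pi\<^sup>2 / 6) - 2 * a * ln (real k + 1))"
    unfolding exp_le_cancel_iff using a q ln_le_harm[of k]
    by (intro diff_mono mult_left_mono) (auto simp: B_def)
  also have "\<dots> = (exp (pi\<^sup>2 / 12 * B) * real (Suc k) powr (- a))\<^sup>2"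
    by (simp add: powr_def power_mult_distrib add.commute flip: exp_add exp_double)
  finally show ?thesis
    unfolding a_def B_def by (rule power2_le_imp_le) auto
qed

lemma summable_Suc_powr: "s < -1 \<Longrightarrow> summable (\<lambda>k. real (Suc k) powr s)"
  using summable_real_powr_iff[of s] summable_Suc_iff[of "\<lambda>k. real k powr s"] by simp

section \<open>The cardinal sine and its antiderivative\<close>

lemma holomorphic_complex_sinc: "complex_sinc holomorphic_on UNIV"
proof -
  have eq: "complex_sinc = (\<lambda>z. if z = 0 then 1 else sin z / z)"
    by (auto simp: complex_sinc_def)
  have "complex_sinc field_differentiable (at z)" for z
  proof (cases "z = 0")
    case True
    then show ?thesis
      unfolding eq field_differentiable_def using has_field_derivative_sin_z_over_z by blast
  next
    case False
    have "(\<lambda>z. sin z / z) field_differentiable (at z)"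
      using False by (intro derivative_intros) (auto simp: field_differentiable_at_sin)
    moreover have "\<forall>\<^sub>F x in nhds z. complex_sinc x = sin x / x"
      using t1_space_nhds[OF False] by eventually_elim (simp add: complex_sinc_def)
    ultimately show ?thesis
      unfolding field_differentiable_def by (subst DERIV_cong_ev[OF refl _ refl]) auto
  qed
  then show ?thesis
    by (simp add: holomorphic_on_def field_differentiable_at_within)
qed

text \<open>The integrand is entire, so it has a primitive g on the whole plane, and the integral
  along the segment is g z - g 0.\<close>

lemma has_field_derivative_sin_integral:
  "(sin_integral has_field_derivative complex_sinc z) (at z)"
proof -
  obtain g where g: "\<And>x. (g has_field_derivative complex_sinc x) (at x)"
    using holomorphic_convex_primitive'[OF convex_UNIV open_UNIV holomorphic_complex_sinc] by auto
  have "sin_integral = (\<lambda>z. g z - g 0)"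
    using contour_integral_primitive[of UNIV g complex_sinc "linepath 0 x" for x] g
    by (auto simp: sin_integral_def fun_eq_iff intro!: contour_integral_unique)
  show ?thesis unfolding \<open>sin_integral = _\<close> using DERIV_diff[OF g DERIV_const] by simp
qed

lemma norm_sin_complex_le: "norm (sin z) \<le> exp \<bar>Im z\<bar>"
proof -
  have "norm (sin z) \<le> (exp (- Im z) + exp (Im z)) / 2"
    using norm_triangle_ineq4[of "exp (\<i> * z)" "exp (- (\<i> * z))"]
    by (simp add: sin_exp_eq norm_divide norm_mult)
  also have "\<dots> \<le> exp \<bar>Im z\<bar>"
    by (cases "Im z \<ge> 0") auto
  finally show ?thesis .
qed

lemma norm_complex_sinc_le: "norm (complex_sinc z) \<le> exp \<bar>Im z\<bar> / norm z" if "z \<noteq> 0"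
  using that by (simp add: complex_sinc_def norm_divide divide_right_mono norm_sin_complex_le)

section \<open>Uniform convergence of the sampling series\<close>

text \<open>Term of the cardinal (Whittaker-Shannon) series that interpolates the binomial
  coefficient at the nonnegative integers. Multiplied by pi, it is the derivative in z of the k-th
  sine integral term.\<close>

definition sampling_term :: "complex \<Rightarrow> complex \<Rightarrow> nat \<Rightarrow> complex" where
  "sampling_term w z k = (w gchoose k) * complex_sinc (of_real pi * z - of_real pi * of_nat k)"

text \<open>The coefficient contributes the exponent -\<delta> and the decay of sinc along the
  integers contributes -1. The constants depend on R alone, and the bound is summable as soon as
  \<delta> > 0.\<close>

lemma norm_sampling_term_le:
  assumes "Re w \<ge> \<delta> - 1" "\<delta> \<ge> 0" "norm w \<le> R" "norm z \<le> R" "real k \<ge> 2 * R + 1"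
  shows "norm (sampling_term w z k)
    \<le> exp (pi\<^sup>2 / 12 * (R + 1)\<^sup>2) * exp (pi * R) * real (Suc k) powr (- \<delta> - 1)"
proof -
  define u where "u = of_real pi * z - of_real pi * complex_of_nat k"
  have "norm (w gchoose k) \<le> exp (pi\<^sup>2 / 12 * (norm (w + 1))\<^sup>2) * real (Suc k) powr (- Re (w + 1))"
    using assms by (intro norm_gbinomial_le) auto
  also have "\<dots> \<le> exp (pi\<^sup>2 / 12 * (R + 1)\<^sup>2) * real (Suc k) powr (- \<delta>)"
    using assms norm_triangle_ineq[of w 1] by (intro mult_mono powr_mono) (auto intro!: power_mono)
  finally have 1: "norm (w gchoose k) \<le> \<dots>" .
  have "u = of_real pi * (z - of_nat k)" by (simp add: u_def algebra_simps)
  then have u: "norm u = pi * norm (z - of_nat k)" "Im u = pi * Im z" by (simp_all add: norm_mult)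
  \<comment> \<open>The threshold 2R + 1 is exactly what makes k - R >= (k + 1)/2; the lost factor 2
    is then absorbed by pi.\<close>
  have "real (Suc k) / 2 \<le> norm (z - of_nat k)"
    using norm_triangle_ineq2[of "of_nat k" z] assms by (simp add: norm_minus_commute)
  then have "2 * (real (Suc k) / 2) \<le> pi * norm (z - of_nat k)"
    using pi_ge_two by (intro mult_mono) auto
  then have nu: "real (Suc k) \<le> norm u" by (simp add: u)
  have "norm (complex_sinc u) \<le> exp \<bar>Im u\<bar> / norm u"
    using nu by (intro norm_complex_sinc_le) auto
  also have "\<dots> \<le> exp (pi * R) / real (Suc k)"
    using nu abs_Im_le_cmod[of z] assms by (intro frac_le) (auto simp: u abs_mult)
  also have "\<dots> = exp (pi * R) * real (Suc k) powr (-1)"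
    by (simp add: powr_minus divide_inverse)
  finally have 2: "norm (complex_sinc u) \<le> \<dots>" .
  have "norm (sampling_term w z k)
      \<le> (exp (pi\<^sup>2 / 12 * (R + 1)\<^sup>2) * real (Suc k) powr (- \<delta>)) * (exp (pi * R) * real (Suc k) powr (-1))"
    unfolding sampling_term_def norm_mult u_def[symmetric] by (intro mult_mono 1 2) auto
  also have "\<dots> = exp (pi\<^sup>2 / 12 * (R + 1)\<^sup>2) * exp (pi * R) * real (Suc k) powr (- \<delta> - 1)"
    by (simp only: powr_add diff_conv_add_uminus mult_ac)
  finally show ?thesis .
qed

text \<open>Both arguments are functions of a parameter x, so that one statement serves for
  holomorphy in z and in w.\<close>

lemma uniformly_convergent_sampling_series:
  assumes "\<delta> > 0"
    and "\<And>x. x \<in> X \<Longrightarrow> Re (w x) \<ge> \<delta> - 1 \<and> norm (w x) \<le> R \<and> norm (z x) \<le> R"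
  shows "uniformly_convergent_on X (\<lambda>n x. \<Sum>k<n. sampling_term (w x) (z x) k)"
proof (rule Weierstrass_m_test'_ev)
  show "\<forall>\<^sub>F k in sequentially. \<forall>x\<in>X. norm (sampling_term (w x) (z x) k)
      \<le> exp (pi\<^sup>2 / 12 * (R + 1)\<^sup>2) * exp (pi * R) * real (Suc k) powr (- \<delta> - 1)"
    using eventually_ge_at_top[of "nat \<lceil>2 * R + 1\<rceil>"]
  proof eventually_elim
    case (elim k)
    then have "2 * R + 1 \<le> real k" by linarith
    then show ?case using assms by (intro ballI norm_sampling_term_le) (auto intro: less_imp_le)
  qed
  show "summable (\<lambda>k. exp (pi\<^sup>2 / 12 * (R + 1)\<^sup>2) * exp (pi * R) * real (Suc k) powr (- \<delta> - 1))"
    using assms(1) by (intro summable_mult summable_Suc_powr) auto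
qed

lemma holomorphic_on_suminf:
  fixes f :: "nat \<Rightarrow> complex \<Rightarrow> complex"
  assumes "open S" "\<And>n. f n holomorphic_on S"
    and "\<And>x. x \<in> S \<Longrightarrow>
      \<exists>d>0. cball x d \<subseteq> S \<and> uniformly_convergent_on (cball x d) (\<lambda>n y. \<Sum>k<n. f k y)"
  shows "(\<lambda>x. \<Sum>n. f n x) holomorphic_on S"
proof (rule holomorphic_uniform_sequence[OF assms(1)])
  show "(\<lambda>x. \<Sum>k<n. f k x) holomorphic_on S" for n
    by (intro holomorphic_on_sum assms)
  show "\<exists>d>0. cball x d \<subseteq> S \<and> uniform_limit (cball x d) (\<lambda>n x. \<Sum>k<n. f k x) (\<lambda>x. \<Sum>n. f n x) sequentially"
    if "x \<in> S" for x
    using assms(3)[OF that] by (simp add: uniformly_convergent_uniform_limit_iff suminf_eq_lim)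
qed

lemma holomorphic_sampling_series_right:
  assumes "Re w > -1"
  shows "(\<lambda>z. \<Sum>k. sampling_term w z k) holomorphic_on UNIV"
proof (rule holomorphic_on_suminf)
  show "(\<lambda>z. sampling_term w z k) holomorphic_on UNIV" for k
    unfolding sampling_term_def
    by (intro holomorphic_intros holomorphic_on_compose_gen[OF _ holomorphic_complex_sinc, unfolded o_def])
      auto
  show "\<exists>d>0. cball x d \<subseteq> UNIV \<and>
      uniformly_convergent_on (cball x d) (\<lambda>n y. \<Sum>k<n. sampling_term w y k)" for x
  proof (intro exI conjI)
    have "norm y \<le> norm x + 1" if "y \<in> cball x 1" for y
      using that norm_triangle_ineq2[of y x] by (auto simp: dist_norm norm_minus_commute)
    then show "uniformly_convergent_on (cball x 1) (\<lambda>n y. \<Sum>k<n. sampling_term w y k)"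
      using assms by (intro uniformly_convergent_sampling_series[of "Re w + 1" _ _ "norm w + norm x + 1"])
        (auto simp: add.assoc intro: add_increasing add_increasing2)
  qed auto
qed auto

lemma holomorphic_sampling_series_left:
  "(\<lambda>w. \<Sum>k. sampling_term w z k) holomorphic_on {w. Re w > -1}"
proof (rule holomorphic_on_suminf)
  show "open {w. Re w > -1}" by (rule open_halfspace_Re_gt)
  show "(\<lambda>w. sampling_term w z k) holomorphic_on {w. Re w > -1}" for k
    unfolding sampling_term_def gbinomial_prod_rev by (intro holomorphic_intros) auto
  fix x :: complex
  assume "x \<in> {w. Re w > -1}"
  \<comment> \<open>Half the distance from x to the line Re = -1, so that Re y >= d - 1 on the
    closed ball of radius d.\<close>
  define d where "d = (Re x + 1) / 2"
  have "d > 0" using \<open>x \<in> _\<close> by (auto simp: d_def)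
  have *: "Re y \<ge> d - 1 \<and> norm y \<le> norm x + d" if "y \<in> cball x d" for y
    using that abs_Re_le_cmod[of "x - y"] norm_triangle_ineq2[of y x]
    by (auto simp: dist_norm norm_minus_commute d_def field_simps abs_le_iff)
  have "Re y > -1" if "y \<in> cball x d" for y using *[OF that] \<open>d > 0\<close> by auto
  moreover have "uniformly_convergent_on (cball x d) (\<lambda>n w. \<Sum>k<n. sampling_term w z k)"
    using * \<open>d > 0\<close> by (intro uniformly_convergent_sampling_series[of d _ _ "norm x + d + norm z"])
      (auto intro: add_increasing add_increasing2)
  ultimately show "\<exists>d>0. cball x d \<subseteq> {w. Re w > -1} \<and>
      uniformly_convergent_on (cball x d) (\<lambda>n w. \<Sum>k<n. sampling_term w z k)"
    using \<open>d > 0\<close> by (intro exI[of _ d]) auto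
qed

section \<open>The sampling series sums to the binomial coefficient\<close>

text \<open>For w > 0 the coefficients are absolutely summable, and for x > 1 the powers of t are
  continuous and at most 1 on [0, 1]. The expanded integrand therefore converges uniformly up to
  both endpoints, which justifies termwise integration.\<close>

lemma sums_Beta_real:
  fixes w x :: real
  assumes "w > 0" "x > 1"
  shows "(\<lambda>k. (-1) ^ k * (w gchoose k) / (x + real k)) sums Beta x (w + 1)"
proof -
  define f where "f = (\<lambda>k t. (-1) ^ k * (w gchoose k) * t powr (x + real k - 1))"
  have "(\<lambda>k. norm (w gchoose k)) = (\<lambda>k. norm (complex_of_real w gchoose k))"
  proof
    fix k
    have "complex_of_real w gchoose k = of_real (w gchoose k)" by (simp add: gbinomial_prod_rev)
    then show "norm (w gchoose k) = norm (complex_of_real w gchoose k)" by simp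
  qed
  moreover have "summable (\<lambda>k. norm (complex_of_real w gchoose k))"
    by (rule summable_comparison_test'[OF summable_mult[OF summable_Suc_powr]])
      (use norm_gbinomial_le[of "of_real w"] assms in auto)
  ultimately have summ: "summable (\<lambda>k. norm (w gchoose k))" by simp
  have lim: "uniform_limit {0..1} (\<lambda>n t. \<Sum>k<n. f k t) (\<lambda>t. \<Sum>k. f k t) sequentially"
  proof (rule Weierstrass_m_test[OF _ summ])
    fix k and t :: real assume "t \<in> {0..1}"
    then have "t powr (x + real k - 1) \<le> 1 powr (x + real k - 1)"
      using assms by (intro powr_mono2) auto
    then show "norm (f k t) \<le> norm (w gchoose k)"
      by (simp add: f_def abs_mult mult_left_le)
  qed
  have cont: "continuous_on {0..1} (\<lambda>t. \<Sum>k<n. f k t)" for n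
    unfolding f_def using assms by (intro continuous_intros continuous_on_powr') auto
  obtain I J where I: "\<And>n. ((\<lambda>t. \<Sum>k<n. f k t) has_integral I n) {0..1}"
    and J: "((\<lambda>t. \<Sum>k. f k t) has_integral J) {0..1}" and IJ: "I \<longlonglongrightarrow> J"
    using uniform_limit_integral[OF lim cont] by auto
  have "((\<lambda>t. \<Sum>k<n. f k t) has_integral (\<Sum>k<n. (-1) ^ k * (w gchoose k) / (x + real k))) {0..1}" for n
  proof (intro has_integral_sum)
    fix k
    have "((\<lambda>t. t powr (x + real k - 1)) has_integral 1 / (x + real k)) {0..1}"
      using has_integral_powr_from_0[of "x + real k - 1" 1] assms by simp
    from has_integral_mult_right[OF this, of "(-1) ^ k * (w gchoose k)"]
    show "(f k has_integral (-1) ^ k * (w gchoose k) / (x + real k)) {0..1}"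
      by (simp add: f_def)
  qed auto
  then have "I = (\<lambda>n. \<Sum>k<n. (-1) ^ k * (w gchoose k) / (x + real k))"
    using I has_integral_unique by blast
  moreover have "J = Beta x (w + 1)"
  proof (rule has_integral_unique[OF J])
    \<comment> \<open>The binomial series is applied for |t| < 1 only; the omitted point t = 1 does
      not affect the integral.\<close>
    have eq: "(\<Sum>k. f k t) = t powr (x - 1) * (1 - t) powr (w + 1 - 1)" if "t \<in> {0..1} - {1}" for t
    proof -
      have "(\<lambda>k. t powr (x - 1) * ((w gchoose k) * (- t) ^ k)) sums (t powr (x - 1) * (1 + - t) powr w)"
        using that by (intro sums_mult gen_binomial_real) auto
      moreover have "t powr (x - 1) * ((w gchoose k) * (- t) ^ k) = f k t" for k
      \<comment> \<open>At t = 0 both sides vanish because \<open>0 powr y = 0\<close>; splitting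
        the exponent into a natural power needs t > 0.\<close>
      proof (cases "t = 0")
        case False
        then have "t powr (x + real k - 1) = t powr (x - 1) * t ^ k"
          using that by (simp add: powr_realpow[symmetric] flip: powr_add) (simp add: algebra_simps)
        then show ?thesis by (simp add: f_def power_minus[of t])
      qed (simp add: f_def)
      ultimately show ?thesis by (simp add: sums_iff)
    qed
    have "((\<lambda>t. t powr (x - 1) * (1 - t) powr (w + 1 - 1)) has_integral Beta x (w + 1)) {0..1}"
      using assms by (intro has_integral_Beta_real) auto
    then show "((\<lambda>t. \<Sum>k. f k t) has_integral Beta x (w + 1)) {0..1}"
      by (rule has_integral_spike_finite[of "{1}", rotated 2]) (use eq in auto)
  qed
  ultimately show ?thesis using IJ by (simp add: sums_def)
qed

text \<open>Since sin (pi (x + k)) = (-1)^k sin (pi x), the series is the Beta series times sin (pi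
  x) / pi. By reflection that factor is 1 / (Gamma(x) Gamma(1 - x)), which cancels the Gamma(x) in
  the Beta function.\<close>

lemma sampling_series_eq_of_real:
  fixes w x :: real
  assumes "w > 0" "x > 1"
  shows "(\<Sum>k. sampling_term (of_real w) (of_real (- x)) k) = gen_binomial (of_real w) (of_real (- x))"
proof -
  have "sampling_term (of_real w) (of_real (- x)) k
      = of_real ((-1) ^ k * (w gchoose k) / (x + real k) * (sin (pi * x) / pi))" for k
  proof -
    have pos: "x + real k > 0" using assms by simp
    have "sin (pi * (x + real k)) = (-1) ^ k * sin (pi * x)"
      using sin_npi[of k] cos_npi[of k] by (simp add: distrib_left sin_add mult.commute)
    moreover have "of_real pi * of_real (- x) - of_real pi * of_nat k
        = complex_of_real (- (pi * (x + real k)))"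
      by (simp add: algebra_simps)
    moreover have "complex_of_real w gchoose k = of_real (w gchoose k)"
      by (simp add: gbinomial_prod_rev)
    moreover have "complex_sinc (complex_of_real (- y)) = of_real (sin y / y)" if "y > 0" for y
      using that by (simp add: complex_sinc_def sin_of_real)
    ultimately show ?thesis
      using pos by (simp add: sampling_term_def mult_ac del: of_real_minus)
  qed
  moreover have "(\<lambda>k. of_real ((-1) ^ k * (w gchoose k) / (x + real k) * (sin (pi * x) / pi)))
      sums complex_of_real (Beta x (w + 1) * (sin (pi * x) / pi))"
    by (intro sums_of_real sums_mult2 sums_Beta_real assms)
  moreover have "complex_of_real (Beta x (w + 1) * (sin (pi * x) / pi)) = gen_binomial (of_real w) (of_real (- x))"
  proof -
    have "complex_of_real x \<notin> \<int>\<^sub>\<le>\<^sub>0"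
      using assms by (auto elim!: nonpos_Ints_cases simp: complex_eq_iff)
    then have inv: "Gamma (complex_of_real x) * rGamma (of_real x) = 1"
      by (simp add: Gamma_def rGamma_eq_zero_iff)
    have "complex_of_real (sin (pi * x) / pi) = rGamma (of_real x) * rGamma (1 - of_real x)"
      using sin_of_real[of "pi * x", where 'a = complex] by (simp add: rGamma_reflection_complex)
    moreover have "complex_of_real (Beta x (w + 1))
        = Gamma (of_real x) * Gamma (of_real w + 1) * rGamma (of_real x + (of_real w + 1))"
      using Beta_complex_of_real[of x "w + 1"] by (simp add: Beta_altdef)
    ultimately have "complex_of_real (Beta x (w + 1) * (sin (pi * x) / pi))
        = (Gamma (of_real x) * rGamma (of_real x)) * (Gamma (of_real w + 1)
          * rGamma (1 - of_real x) * rGamma (of_real x + (of_real w + 1)))"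
      by (simp only: of_real_mult mult_ac)
    then show ?thesis by (simp add: inv gen_binomial_def add_ac)
  qed
  ultimately show ?thesis by (simp add: sums_iff)
qed

text \<open>Supplies the accumulation point for both uses of the identity theorem.\<close>

lemma islimpt_of_real_greaterThan: "complex_of_real (a + 1) islimpt of_real ` {a<..}"
  unfolding islimpt_approachable
proof (intro allI impI)
  fix e :: real assume "e > 0"
  then show "\<exists>x'\<in>complex_of_real ` {a<..}. x' \<noteq> of_real (a + 1) \<and> dist x' (of_real (a + 1)) < e"
    by (intro bexI[of _ "of_real (a + 1 + e / 2)"])
      (auto simp: dist_of_real dist_real_def simp del: of_real_add)
qed

lemma holomorphic_gen_binomial_left: "(\<lambda>w. gen_binomial w z) holomorphic_on {w. Re w > -1}"
proof -
  have "w + 1 \<notin> \<int>\<^sub>\<le>\<^sub>0" if "Re w > -1" for w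
    using that by (auto elim!: nonpos_Ints_cases simp: complex_eq_iff)
  then show ?thesis
    unfolding gen_binomial_def by (intro holomorphic_intros) auto
qed

lemma holomorphic_gen_binomial_right: "(\<lambda>z. gen_binomial w z) holomorphic_on UNIV"
  unfolding gen_binomial_def by (intro holomorphic_intros)

lemma sampling_series_eq:
  assumes "Re w > -1"
  shows "(\<Sum>k. sampling_term w z k) = gen_binomial w z"
proof -
  \<comment> \<open>Continuation in w from the positive reals to the half-plane, with z = -x
    fixed.\<close>
  have *: "(\<Sum>k. sampling_term w (of_real (- x)) k) - gen_binomial w (of_real (- x)) = 0" if "x > 1" for x
  proof (rule analytic_continuation[where S = "{w. Re w > -1}" and U = "of_real ` {0<..}"
        and f = "\<lambda>w. (\<Sum>k. sampling_term w (of_real (- x)) k) - gen_binomial w (of_real (- x))"])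
    show "complex_of_real (0 + 1) islimpt of_real ` {0<..}" by (rule islimpt_of_real_greaterThan)
    show "connected {w. Re w > -1}" by (intro convex_connected convex_halfspace_Re_gt)
    show "open {w. Re w > -1}" by (rule open_halfspace_Re_gt)
  qed (use assms that sampling_series_eq_of_real in
      \<open>auto intro!: holomorphic_on_diff holomorphic_sampling_series_left holomorphic_gen_binomial_left\<close>)
  \<comment> \<open>Continuation in z. Reflecting the variable turns the known points z = -x into
    the ray of reals above 1.\<close>
  have "(\<Sum>k. sampling_term w (- (- z)) k) - gen_binomial w (- (- z)) = 0"
  proof (rule analytic_continuation[where S = UNIV and U = "of_real ` {1<..}"
        and f = "\<lambda>z. (\<Sum>k. sampling_term w (- z) k) - gen_binomial w (- z)"])
    show "complex_of_real (1 + 1) islimpt of_real ` {1<..}" by (rule islimpt_of_real_greaterThan)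
    have "(\<lambda>z. (\<Sum>k. sampling_term w z k) - gen_binomial w z) holomorphic_on UNIV"
      by (intro holomorphic_on_diff holomorphic_sampling_series_right holomorphic_gen_binomial_right assms)
    then show "(\<lambda>z. (\<Sum>k. sampling_term w (- z) k) - gen_binomial w (- z)) holomorphic_on UNIV"
      using holomorphic_on_compose[of uminus UNIV] holomorphic_on_subset
      by (fastforce simp: o_def intro: holomorphic_intros)
  qed (use * in auto)
  then show ?thesis by simp
qed

section \<open>Convergence of the series of sine integrals\<close>

text \<open>Twice the n-th partial sum of f equals the n-th partial sum of the paired series plus f
  0 - f n.\<close>

lemma summable_if_consecutive_sums:
  fixes f :: "nat \<Rightarrow> 'a::banach"
  assumes "f \<longlonglongrightarrow> 0" "summable (\<lambda>k. f k + f (Suc k))"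
  shows "summable f"
proof -
  have "(\<lambda>n. ((\<Sum>k<n. f k + f (Suc k)) + f 0 - f n) /\<^sub>R 2)
      \<longlonglongrightarrow> ((\<Sum>k. f k + f (Suc k)) + f 0 - 0) /\<^sub>R 2"
    by (intro tendsto_intros summable_LIMSEQ assms)
  moreover have "(\<Sum>k<n. f k + f (Suc k)) + f 0 - f n = 2 *\<^sub>R (\<Sum>k<n. f k)" for n
    by (induction n) (simp_all add: algebra_simps scaleR_2)
  ultimately show ?thesis by (auto simp: summable_def sums_def)
qed

lemma harm_le_ln: "n > 0 \<Longrightarrow> harm n \<le> 1 + ln (real n)"
proof (induction n rule: nat_induct_non_zero)
  case (Suc n)
  have "ln (real n / real (Suc n)) \<le> real n / real (Suc n) - 1"
    using Suc by (intro ln_le_minus_one) auto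
  also have "\<dots> = - inverse (real (Suc n))" by (simp add: field_simps)
  finally have "inverse (real (Suc n)) \<le> ln (real (Suc n)) - ln (real n)"
    using Suc by (simp add: ln_div)
  then show ?case using Suc by (simp add: harm_Suc)
qed (simp add: harm_def)

text \<open>Trades the logarithm for an arbitrarily small power, by ln y <= y^e / e. Passing to
  \<open>Suc n\<close> first also covers n = 0.\<close>

lemma harm_le_powr:
  assumes "e > 0"
  shows "harm n \<le> (1 + 1 / e) * real (Suc n) powr e"
proof -
  have "harm n \<le> (harm (Suc n) :: real)" by (intro harm_mono) auto
  also have "\<dots> \<le> 1 + ln (real (Suc n))" by (rule harm_le_ln) auto
  also have "\<dots> \<le> real (Suc n) powr e + real (Suc n) powr e / e"
    using assms by (intro add_mono ln_powr_bound ge_one_powr_ge_zero) auto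
  finally show ?thesis by (simp add: field_simps)
qed

text \<open>
  For \<open>Re w \<le> 0\<close> the series need not converge absolutely: the coefficients asymptotically
  alternate in sign, so pairing consecutive terms gains a factor of order \<open>1/k\<close>, by Pascal's rule
  for the coefficients and by slow variation of \<open>b\<close>.
\<close>
lemma summable_gbinomial_mult:
  fixes w :: complex
  assumes "Re w > -1" and b0: "b 0 = 0" and diff: "\<And>k. norm (b (Suc k) - b k) \<le> D / real (Suc k)"
  shows "summable (\<lambda>k. (w gchoose k) * b k)"
proof -
  define a where "a = Re (w + 1)"
  define E where "E = (\<lambda>u::complex. exp (pi\<^sup>2 / 12 * (norm (u + 1))\<^sup>2))"
  define D' where "D' = D * (1 + 1 / (a / 2))"
  have a: "a > 0" using assms by (simp add: a_def)
  have D: "D \<ge> 0" using order_trans[OF norm_ge_zero diff[of 0]] by simp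
  have E: "E u \<ge> 0" for u by (simp add: E_def)
  have Cw: "norm (w gchoose k) \<le> E w * real (Suc k) powr (- a)" for k
    unfolding E_def a_def using assms by (intro norm_gbinomial_le) auto
  have Cw1: "norm (w + 1 gchoose k) \<le> E (w + 1) * real (Suc k) powr (- a - 1)" for k
    using norm_gbinomial_le[of "w + 1" k] assms by (simp add: E_def a_def)
  \<comment> \<open>Telescoping gives b at most harmonic growth. The exponent a / 2 spends half of
    the decay of the coefficients on it, so the products still tend to 0.\<close>
  have "norm (b k) \<le> D * harm k" for k
  proof (induction k)
    case (Suc k)
    show ?case
      using norm_triangle_sub[of "b (Suc k)" "b k"] Suc diff[of k]
      by (simp add: harm_Suc distrib_left divide_inverse)
  qed (simp add: b0 harm_def)
  also have "D * harm k \<le> D' * real (Suc k) powr (a / 2)" for k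
    using mult_left_mono[OF harm_le_powr[of "a / 2" k] D] a by (simp add: D'_def mult.assoc)
  finally have b: "norm (b k) \<le> D' * real (Suc k) powr (a / 2)" for k .
  have "(\<lambda>k. (w gchoose k) * b k) \<longlonglongrightarrow> 0"
  proof (rule Lim_null_comparison)
    have "norm ((w gchoose k) * b k) \<le> E w * D' * real (Suc k) powr (- (a / 2))" for k
    proof -
      have "norm ((w gchoose k) * b k)
          \<le> (E w * real (Suc k) powr (- a)) * (D' * real (Suc k) powr (a / 2))"
        unfolding norm_mult by (intro mult_mono Cw b) (auto simp: E_def)
      also have "\<dots> = E w * D' * (real (Suc k) powr (- a) * real (Suc k) powr (a / 2))"
        by (simp only: mult_ac)
      finally show ?thesis by (simp flip: powr_add)
    qed
    then show "\<forall>\<^sub>F k in sequentially.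
        norm ((w gchoose k) * b k) \<le> E w * D' * real (Suc k) powr (- (a / 2))" by simp
    have "(\<lambda>k. real (Suc k) powr (- (a / 2))) \<longlonglongrightarrow> 0"
      using a by (intro tendsto_neg_powr filterlim_compose[OF filterlim_real_sequentially filterlim_Suc]) auto
    from tendsto_mult_right_zero[OF this, of "E w * D'"]
    show "(\<lambda>k. E w * D' * real (Suc k) powr (- (a / 2))) \<longlonglongrightarrow> 0" .
  qed
  moreover have "summable (\<lambda>k. (w gchoose k) * b k + (w gchoose Suc k) * b (Suc k))"
  proof (rule summable_comparison_test')
    show "summable (\<lambda>k. (E (w + 1) * D' + E w * D) * real (Suc k) powr (- 1 - a / 2))"
      using a by (intro summable_mult summable_Suc_powr) auto
    fix k
    define m where "m = real (Suc k)"
    have m: "m \<ge> 1" by (simp add: m_def)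
    \<comment> \<open>Summation by parts: by Pascal's rule the first coefficient belongs to w + 1
      and decays one power faster, while the second summand gains 1/(k + 1) from the increment of
      b.\<close>
    have "(w gchoose k) * b k + (w gchoose Suc k) * b (Suc k)
        = (w + 1 gchoose Suc k) * b k + (w gchoose Suc k) * (b (Suc k) - b k)"
      unfolding gbinomial_Suc_Suc by (simp add: algebra_simps)
    also have "norm \<dots> \<le> norm (w + 1 gchoose Suc k) * norm (b k)
        + norm (w gchoose Suc k) * norm (b (Suc k) - b k)"
      by (metis norm_mult norm_triangle_ineq)
    also have "\<dots> \<le> (E (w + 1) * m powr (- a - 1)) * (D' * m powr (a / 2))
        + (E w * m powr (- a / 2)) * (D * m powr (- 1))"
    proof (intro add_mono mult_mono)
      have "real (Suc (Suc k)) powr (- a - 1) \<le> m powr (- a - 1)"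
        using a by (intro powr_mono2') (auto simp: m_def)
      then show "norm (w + 1 gchoose Suc k) \<le> E (w + 1) * m powr (- a - 1)"
        using Cw1[of "Suc k"] E by (meson mult_left_mono order_trans)
      have "real (Suc (Suc k)) powr (- a) \<le> m powr (- a)"
        using a by (intro powr_mono2') (auto simp: m_def)
      \<comment> \<open>Weakened deliberately, so that both summands end with the exponent -1 -
        a/2.\<close>
      also have "\<dots> \<le> m powr (- a / 2)" using a m by (intro powr_mono) auto
      finally show "norm (w gchoose Suc k) \<le> E w * m powr (- a / 2)"
        using Cw[of "Suc k"] E by (meson mult_left_mono order_trans)
      show "norm (b (Suc k) - b k) \<le> D * m powr (- 1)"
        using diff[of k] by (simp add: m_def powr_minus divide_inverse)
    qed (use b[of k] E in \<open>auto simp: m_def\<close>)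
    also have "\<dots> = E (w + 1) * D' * (m powr (- a - 1) * m powr (a / 2))
        + E w * D * (m powr (- a / 2) * m powr (- 1))"
      by (simp only: mult_ac)
    also have "\<dots> = (E (w + 1) * D' + E w * D) * m powr (- 1 - a / 2)"
    proof -
      have "- a - 1 + a / 2 = - 1 - a / 2" "- a / 2 + - 1 = - 1 - a / 2" by simp_all
      then show ?thesis by (simp only: powr_add[symmetric] distrib_right)
    qed
    finally show "norm ((w gchoose k) * b k + (w gchoose Suc k) * b (Suc k))
        \<le> (E (w + 1) * D' + E w * D) * real (Suc k) powr (- 1 - a / 2)"
      by (simp add: m_def)
  qed
  ultimately show ?thesis by (rule summable_if_consecutive_sums)
qed

text \<open>The segment has length pi, and on it the integrand is at most 1 / (pi k).\<close>

lemma norm_sin_integral_diff_le: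
  assumes "k > 0"
  shows "norm (sin_integral (- (of_real pi * of_nat (Suc k))) - sin_integral (- (of_real pi * of_nat k)))
    \<le> 1 / real k"
proof -
  define A B where "A = complex_of_real (- (pi * real (Suc k)))" and "B = complex_of_real (- (pi * real k))"
  have "norm (sin_integral A - sin_integral B) \<le> 1 / (pi * real k) * norm (A - B)"
  proof (rule field_differentiable_bound)
    fix u assume "u \<in> closed_segment A B"
    then obtain t where "u = of_real t" "t \<le> - (pi * real k)"
      unfolding A_def B_def closed_segment_of_real by (auto simp: closed_segment_eq_real_ivl algebra_simps)
    then have "Im u = 0" "pi * real k \<le> norm u" by auto
    moreover have "pi * real k > 0" using assms by simp
    ultimately show "norm (complex_sinc u) \<le> 1 / (pi * real k)"
      using norm_complex_sinc_le[of u] frac_le[of 1 1 "pi * real k" "norm u"] by fastforce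
  qed (auto intro: has_field_derivative_at_within has_field_derivative_sin_integral)
  also have "A - B = of_real (- pi)" by (simp add: A_def B_def algebra_simps)
  finally show ?thesis by (simp add: A_def B_def)
qed

lemma summable_sin_integral_0:
  assumes "Re w > -1"
  shows "summable (\<lambda>k. (w gchoose k) * sin_integral (- (of_real pi * of_nat k)))"
proof (rule summable_gbinomial_mult[OF assms])
  \<comment> \<open>For k >= 1, 2 suffices because 1/k <= 2/(k + 1). The other entry covers k = 0,
    where the increment is Si(-pi).\<close>
  define D where "D = max 2 (norm (sin_integral (- of_real pi)))"
  have zero: "sin_integral 0 = 0" by (simp add: sin_integral_def)
  then show "sin_integral (- (of_real pi * of_nat 0)) = 0" by simp
  show "norm (sin_integral (- (of_real pi * of_nat (Suc k))) - sin_integral (- (of_real pi * of_nat k)))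
      \<le> D / real (Suc k)" for k
  proof (cases "k = 0")
    case False
    then have "1 / real k \<le> 2 / real (Suc k)" by (simp add: field_simps)
    also have "\<dots> \<le> D / real (Suc k)" by (intro divide_right_mono) (auto simp: D_def)
    finally show ?thesis using norm_sin_integral_diff_le[of k] False by simp
  qed (simp add: zero D_def)
qed

lemma has_field_derivative_sin_integral_series:
  assumes "Re w > -1"
  defines "F \<equiv> \<lambda>z k. (w gchoose k) * sin_integral (of_real pi * z - of_real pi * of_nat k)"
  shows "summable (F z)" "((\<lambda>z. \<Sum>k. F z k) has_field_derivative of_real pi * gen_binomial w z) (at z)"
proof -
  \<comment> \<open>Termwise differentiation needs one convex set containing both z and the base
    point 0, at which convergence is known; convergence at z then follows as well.\<close>
  define S where "S = ball (0::complex) (norm z + 1)"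
  have conv: "uniformly_convergent_on S (\<lambda>n x. \<Sum>k<n. sampling_term w x k)"
    using assms by (intro uniformly_convergent_sampling_series[of "Re w + 1" _ _ "norm w + norm z + 1"])
      (auto simp: S_def add.assoc intro: add_increasing add_increasing2)
  have conv': "uniformly_convergent_on S (\<lambda>n x. \<Sum>k<n. of_real pi * sampling_term w x k)"
    using uniformly_convergent_mult[OF conv, of "of_real pi"]
    by (simp add: sum_distrib_left)
  have deriv: "((\<lambda>z. F z k) has_field_derivative of_real pi * sampling_term w x k) (at x within S)" for k x
    unfolding F_def sampling_term_def
    by (rule has_field_derivative_at_within)
      (auto intro!: derivative_eq_intros DERIV_chain2[OF has_field_derivative_sin_integral])
  have at_0: "summable (F 0)" using summable_sin_integral_0[OF assms(1)] by (simp add: F_def)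
  have z: "z \<in> interior S" "0 \<in> S" by (auto simp: S_def intro: add_nonneg_pos)
  have "convex S" by (simp add: S_def)
  note * = has_field_derivative_series'[OF this deriv conv' z(2) at_0 z(1)]
  show "summable (F z)" by (rule *(1))
  have "summable (sampling_term w z)"
    using uniformly_convergent_imp_convergent[OF conv, of z] z(1) interior_subset
    by (auto simp: summable_iff_convergent)
  then have "(\<Sum>k. of_real pi * sampling_term w z k) = of_real pi * gen_binomial w z"
    by (simp add: suminf_mult sampling_series_eq[OF assms(1)])
  with *(2) show "((\<lambda>z. \<Sum>k. F z k) has_field_derivative of_real pi * gen_binomial w z) (at z)" by simp
qed

theorem mainTheorem5:
  fixes w :: complex
  assumes "Re w > -1"
  shows "(\<forall>z::complex. summable (\<lambda>k::nat. gen_binomial w (of_nat k) *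
            sin_integral (of_real pi * z - of_real pi * of_nat k))) \<and>
         (\<forall>z::complex. ((\<lambda>z. 1 / of_real pi * (\<Sum>k::nat. gen_binomial w (of_nat k) *
            sin_integral (of_real pi * z - of_real pi * of_nat k)))
          has_field_derivative gen_binomial w z) (at z))"
proof -
  \<comment> \<open>Keeps Gamma (w + 1) away from its poles, so that \<open>gen_binomial\<close>
    agrees with \<open>gchoose\<close> at the natural numbers.\<close>
  have "w + 1 \<notin> \<int>\<^sub>\<le>\<^sub>0"
    using assms by (auto elim!: nonpos_Ints_cases simp: complex_eq_iff)
  note binom = gen_binomial_of_nat[OF this]
  note * = has_field_derivative_sin_integral_series[OF assms]
  show ?thesis
    unfolding binom using *(1) DERIV_cmult[OF *(2), of "1 / of_real pi"] by simp
qed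

end
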